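(* Let $P$ be a periodic isonemal prefabric of order greater than $4$ with only parallel symmetry axes, that is, whose planar symmetry group $G_1$ contains no non-trivial rotation and contains reflections or glide-reflections, the axes of which are all parallel to one another. Then the prefabric obtained from $P$ by doubling is not isonemal.
   Context: **Prefabrics and designs.** The plane is tessellated by the unit square cells $[i,i+1]\times[j,j+1]$, $i,j\in\mathbb{Z}$. The vertical strips $[i,i+1]\times\mathbb{R}$ are the strands called warps and the horizontal strips $\mathbb{R}\times[j,j+1]$ are the strands called wefts. A (two-layer) prefabric specifies, for each cell, which of the two strands crossing there is uppermost. It is encoded by its design $c:\mathbb{Z}^2\to\{\text{dark},\text{pale}\}$, where $c(i,j)$ is dark if the warp is uppermost in cell $(i,j)$ and pale if the weft is uppermost. **Symmetries.** Let $\tau$ denote reflection in the plane of the prefabric (reversing which strand is uppermost everywhere). A symmetry is a pair $(g,\varepsilon)$, with $\varepsilon\in\{e,\tau\}$, where $g$ is an isometry of the plane mapping strands to strands such that, for every cell $s$, the strand uppermost in $s$ is mapped by $g$ to the strand that is uppermost in $g(s)$ if $\varepsilon=e$, and to the strand that is lowermost in $g(s)$ if $\varepsilon=\tau$. (Hence a $g$ preserving the strand directions preserves colours of the design if $\varepsilon=e$ and reverses them if $\varepsilon=\tau$; a $g$ interchanging warps and wefts reverses colours if $\varepsilon=e$ and preserves them if $\varepsilon=\tau$.) The symmetries form the group $G$. $G_1$ is the group of all $g$ such that $(g,e)$ or $(g,\tau)$ is in $G$. **Periodic, isonemal, order.** The prefabric is periodic if $G$ contains pairs $(t_1,e)$,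 $(t_2,e)$ with $t_1,t_2$ linearly independent translations. It is isonemal if its symmetry group acts transitively on the set of all strands (warps and wefts together). The order of a periodic isonemal prefabric is the (least) period of the colour sequence along a strand; it is the same for all strands. **Doubling.** Doubling a prefabric replaces each strand by a pair of adjacent strands with the same behaviour: the doubled prefabric has design $c'(i,j)=c(\lfloor i/2\rfloor,\lfloor j/2\rfloor)$. *)

theory Defs
  imports "HOL-Analysis.Analysis"
begin

text \<open>The plane is the type \<^typ>\<open>complex\<close>, with its Euclidean distance.\<close>

datatype strand = Warp int | Weft int

fun strip :: "strand \<Rightarrow> complex set" where
  "strip (Warp i) = {z. of_int i \<le> Re z \<and> Re z \<le> of_int i + 1}"
| "strip (Weft j) = {z. of_int j \<le> Im z \<and> Im z \<le> of_int j + 1}"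

definition cell :: "int \<Rightarrow> int \<Rightarrow> complex set" where
  "cell i j = strip (Warp i) \<inter> strip (Weft j)"

datatype colour = Dark | Pale

text \<open>A prefabric is identified with its design.\<close>

type_synonym design = "int \<Rightarrow> int \<Rightarrow> colour"

definition upper :: "design \<Rightarrow> int \<Rightarrow> int \<Rightarrow> strand" where
  "upper c i j = (case c i j of Dark \<Rightarrow> Warp i | Pale \<Rightarrow> Weft j)"

definition lower :: "design \<Rightarrow> int \<Rightarrow> int \<Rightarrow> strand" where
  "lower c i j = (case c i j of Dark \<Rightarrow> Weft j | Pale \<Rightarrow> Warp i)"

text \<open>\<open>Flip\<close> is the reflection in the plane of the prefabric, \<open>No_Flip\<close> the identity.\<close>

datatype side = No_Flip | Flip

definition plane_isometry :: "(complex \<Rightarrow> complex) \<Rightarrow> bool" where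
  "plane_isometry g \<longleftrightarrow> (\<forall>x y. dist (g x) (g y) = dist x y)"

text \<open>Surjectivity need not be demanded: a distance-preserving self-map of the Euclidean plane
  is bijective.\<close>

definition symmetry_group :: "design \<Rightarrow> ((complex \<Rightarrow> complex) \<times> side) set" where
  "symmetry_group c = {(g, \<epsilon>). plane_isometry g
     \<and> (\<forall>s. \<exists>t. g ` strip s = strip t)
     \<and> (\<forall>i j. \<exists>k l. g ` cell i j = cell k l
          \<and> g ` strip (upper c i j) = strip (case \<epsilon> of No_Flip \<Rightarrow> upper c k l | Flip \<Rightarrow> lower c k l))}"

definition planar_group :: "design \<Rightarrow> (complex \<Rightarrow> complex) set" where
  "planar_group c = {g. \<exists>\<epsilon>. (g, \<epsilon>) \<in> symmetry_group c}"

definition periodic :: "design \<Rightarrow> bool" where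
  "periodic c \<longleftrightarrow> (\<exists>u v. u \<noteq> v \<and> independent {u, v}
     \<and> ((\<lambda>z. u + z), No_Flip) \<in> symmetry_group c \<and> ((\<lambda>z. v + z), No_Flip) \<in> symmetry_group c)"

definition isonemal :: "design \<Rightarrow> bool" where
  "isonemal c \<longleftrightarrow> (\<forall>s t. \<exists>(g, \<epsilon>) \<in> symmetry_group c. g ` strip s = strip t)"

fun colours_along :: "design \<Rightarrow> strand \<Rightarrow> int \<Rightarrow> colour" where
  "colours_along c (Warp i) k = c i k"
| "colours_along c (Weft j) k = c k j"

definition strand_period :: "design \<Rightarrow> strand \<Rightarrow> nat" where
  "strand_period c s =
     (LEAST p. p > 0 \<and> (\<forall>k. colours_along c s (k + int p) = colours_along c s k))"

text \<open>The least period is the same along all strands of a periodic isonemal prefabric, so the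
  order may be read off any one of them; for other designs \<open>prefabric_order\<close> has no meaning.\<close>

definition prefabric_order :: "design \<Rightarrow> nat" where
  "prefabric_order c = strand_period c (Warp 0)"

definition rotation :: "complex \<Rightarrow> real \<Rightarrow> complex \<Rightarrow> complex" where
  "rotation p \<theta> z = p + cis \<theta> * (z - p)"

definition line :: "complex \<Rightarrow> complex \<Rightarrow> complex set" where
  "line p u = {p + of_real t * u | t. True}"

text \<open>For \<open>u \<noteq> 0\<close>, the following fixes \<^term>\<open>line p u\<close> pointwise and sends
  \<open>p + w * u\<close> to \<open>p + cnj w * u\<close>, i.e. it is the reflection in that line.\<close>

definition reflection :: "complex \<Rightarrow> complex \<Rightarrow> complex \<Rightarrow> complex" where
  "reflection p u z = p + cnj ((z - p) / u) * u"

definition glide_reflection :: "complex \<Rightarrow> complex \<Rightarrow> real \<Rightarrow> complex \<Rightarrow> complex" where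
  "glide_reflection p u s z = reflection p u z + of_real s * u"

definition symmetry_axes :: "design \<Rightarrow> complex set set" where
  "symmetry_axes c = {line p u | p u. u \<noteq> 0
     \<and> (reflection p u \<in> planar_group c
        \<or> (\<exists>s. s \<noteq> 0 \<and> glide_reflection p u s \<in> planar_group c))}"

definition only_parallel_axes :: "design \<Rightarrow> bool" where
  "only_parallel_axes c \<longleftrightarrow>
     (\<forall>p \<theta>. rotation p \<theta> \<in> planar_group c \<longrightarrow> rotation p \<theta> = id)
     \<and> symmetry_axes c \<noteq> {}
     \<and> (\<forall>L \<in> symmetry_axes c. \<forall>M \<in> symmetry_axes c. affine_parallel L M)"

definition doubling :: "design \<Rightarrow> design" where
  "doubling c i j = c (i div 2) (j div 2)"

end

theory Submission
  imports Defs
begin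

text \<open>Isonemality of \<open>P\<close> yields a symmetry exchanging warps and wefts; since there are no rotations, it
  reflects in a diagonal direction, so all axes are diagonal. If the doubled design is isonemal, some
  symmetry of it carries the warp \<open>0\<close> to the warp \<open>1\<close>. If that symmetry respects the two-by-two
  blocks, halving it gives a symmetry of \<open>P\<close> that reverses the horizontal direction while keeping
  warps warps, which is a half-turn or has a vertical axis. Otherwise it shifts the blocks by an odd
  amount in some direction, which makes \<open>P\<close> constant in that direction and so of order \<open>1\<close>.\<close>

section \<open>Strands, cells and the lattice maps acting on them\<close>

lemma strip_eq_iff: "strip s = strip t \<longleftrightarrow> s = t"
proof
  assume eq: "strip s = strip t"
  have mem: "z \<in> strip s \<longleftrightarrow> z \<in> strip t" for z
    by (simp add: eq)
  show "s = t"
  proof (cases s; cases t)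
    fix i k assume st: "s = Warp i" "t = Warp k"
    show ?thesis
      using mem[of "Complex i 0"] mem[of "Complex k 0"] st by auto
  next
    fix i k assume st: "s = Weft i" "t = Weft k"
    show ?thesis
      using mem[of "Complex 0 i"] mem[of "Complex 0 k"] st by auto
  next
    \<comment> \<open>A point of the warp at height \<open>k + 2\<close> lies above the weft
      \<open>k\<close>, which ends at height \<open>k + 1\<close>.\<close>
    fix i k assume st: "s = Warp i" "t = Weft k"
    show ?thesis
      using mem[of "Complex i (k + 2)"] st by auto
  next
    fix i k assume st: "s = Weft i" "t = Warp k"
    show ?thesis
      using mem[of "Complex (k + 2) i"] st by auto
  qed
qed auto

lemma cell_eq_iff: "cell i j = cell k l \<longleftrightarrow> i = k \<and> j = l"
proof
  assume eq: "cell i j = cell k l"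
  have mem: "z \<in> cell i j \<longleftrightarrow> z \<in> cell k l" for z
    by (simp add: eq)
  show "i = k \<and> j = l"
    using mem[of "Complex i j"] mem[of "Complex k l"] by (auto simp: cell_def)
qed auto

text \<open>For signs \<open>s\<close> and \<open>t\<close> in {1, -1} these turn out to be all the
  isometries that permute the strands and keep warps warps; composing them with
  \<open>transp\<close>, the reflection in the main diagonal, gives those that exchange warps and
  wefts.\<close>

definition lattice_map :: "int \<Rightarrow> int \<Rightarrow> int \<Rightarrow> int \<Rightarrow> complex \<Rightarrow> complex" where
  "lattice_map s k t l z = Complex (of_int s * Re z + of_int k) (of_int t * Im z + of_int l)"

definition transp :: "complex \<Rightarrow> complex" where
  "transp z = Complex (Im z) (Re z)"

text \<open>The reflection \<open>x \<mapsto> k - x\<close> sends the interval \<open>[i, i + 1]\<close> to \<open>[k - 1 - i, k - i]\<close>.\<close>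

definition strand_index :: "int \<Rightarrow> int \<Rightarrow> int \<Rightarrow> int" where
  "strand_index s k i = (if s = 1 then i + k else k - 1 - i)"

fun map_strand :: "int \<Rightarrow> int \<Rightarrow> int \<Rightarrow> int \<Rightarrow> strand \<Rightarrow> strand" where
  "map_strand s k t l (Warp i) = Warp (strand_index s k i)"
| "map_strand s k t l (Weft j) = Weft (strand_index t l j)"

fun transp_strand :: "strand \<Rightarrow> strand" where
  "transp_strand (Warp i) = Weft i"
| "transp_strand (Weft j) = Warp j"

lemma surj_strand_index: "\<exists>i. strand_index s k i = j"
  by (rule exI[of _ "if s = 1 then j - k else k - 1 - j"]) (auto simp: strand_index_def)

lemma lattice_map_strip:
  assumes "s \<in> {1, -1}" "t \<in> {1, -1}"
  shows "lattice_map s k t l ` strip r = strip (map_strand s k t l r)"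
proof (intro set_eqI iffI)
  fix w assume "w \<in> lattice_map s k t l ` strip r"
  then show "w \<in> strip (map_strand s k t l r)"
    using assms by (cases r) (auto simp: lattice_map_def strand_index_def)
next
  fix w assume w: "w \<in> strip (map_strand s k t l r)"
  \<comment> \<open>The preimage comes from the inverse map, because each sign is its own
    inverse.\<close>
  have "w = lattice_map s k t l (Complex (s * (Re w - k)) (t * (Im w - l)))"
    using assms by (auto simp: lattice_map_def complex_eq_iff)
  moreover have "Complex (s * (Re w - k)) (t * (Im w - l)) \<in> strip r"
    using assms w by (cases r) (auto simp: strand_index_def)
  ultimately show "w \<in> lattice_map s k t l ` strip r"
    by blast
qed

lemma inj_lattice_map:
  assumes "s \<in> {1, -1}" "t \<in> {1, -1}"
  shows "inj (lattice_map s k t l)"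
  using assms by (auto simp: inj_def lattice_map_def complex_eq_iff)

text \<open>Injectivity makes the image of a cell the intersection of the images of its two
  strips.\<close>

lemma lattice_map_cell:
  assumes "s \<in> {1, -1}" "t \<in> {1, -1}"
  shows "lattice_map s k t l ` cell i j = cell (strand_index s k i) (strand_index t l j)"
  by (simp add: cell_def image_Int[OF inj_lattice_map[OF assms]] lattice_map_strip[OF assms]
      del: strip.simps)

lemma transp_strip: "transp ` strip r = strip (transp_strand r)"
proof (intro set_eqI iffI)
  fix w assume "w \<in> strip (transp_strand r)"
  then have "transp w \<in> strip r"
    by (cases r) (auto simp: transp_def)
  moreover have "w = transp (transp w)"
    by (simp add: transp_def)
  ultimately show "w \<in> transp ` strip r"
    by blast
qed (cases r; auto simp: transp_def)

lemma inj_transp: "inj transp"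
  by (auto simp: inj_def transp_def complex_eq_iff)

lemma transp_cell: "transp ` cell i j = cell j i"
  by (simp add: cell_def image_Int[OF inj_transp] transp_strip Int_commute del: strip.simps)

section \<open>Classification of the isometries that map strands to strands\<close>

lemma plane_isometry_lattice_map:
  assumes "s \<in> {1, -1}" "t \<in> {1, -1}"
  shows "plane_isometry (lattice_map s k t l)"
  using assms
  by (auto simp: plane_isometry_def lattice_map_def dist_complex_def cmod_def power2_commute
      power2_eq_square algebra_simps)

text \<open>Subtracting \<open>g 0\<close> leaves an isometry fixing the origin, hence an orthogonal
  linear map; \<open>a\<close> and \<open>d\<close> are its values at 1 and \<open>\<i>\<close>,
  which are orthonormal.\<close>

lemma plane_isometry_affine:
  assumes "plane_isometry g"
  obtains a d where "\<And>z. g z = g 0 + of_real (Re z) * a + of_real (Im z) * d"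
    "(Re a)\<^sup>2 + (Im a)\<^sup>2 = 1" "(Re d)\<^sup>2 + (Im d)\<^sup>2 = 1" "Re a * Re d + Im a * Im d = 0"
proof -
  define f where "f z = g z - g 0" for z
  have "orthogonal_transformation f"
    using assms unfolding orthogonal_transformation_isometry
    by (auto simp: f_def plane_isometry_def dist_norm)
  then have lin: "linear f" and inner: "\<And>v w. f v \<bullet> f w = v \<bullet> w"
    by (auto simp: orthogonal_transformation_def)
  have f: "f z = of_real (Re z) * f 1 + of_real (Im z) * f \<i>" for z
  proof -
    have "z = Re z *\<^sub>R 1 + Im z *\<^sub>R \<i>"
      by (simp add: complex_eq_iff)
    then have "f z = f (Re z *\<^sub>R 1 + Im z *\<^sub>R \<i>)"
      by (rule arg_cong)
    also have "\<dots> = Re z *\<^sub>R f 1 + Im z *\<^sub>R f \<i>"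
      by (simp only: linear_add[OF lin] linear_scale[OF lin])
    finally show ?thesis
      by (simp add: scaleR_conv_of_real)
  qed
  show thesis
  proof (rule that)
    fix z show "g z = g 0 + of_real (Re z) * f 1 + of_real (Im z) * f \<i>"
      using f[of z] by (simp add: f_def algebra_simps)
  qed (use inner[of 1 1] inner[of \<i> \<i>] inner[of 1 \<i>] in
       \<open>auto simp: inner_complex_def power2_eq_square\<close>)
qed

lemma bounded_affine_imp_zero:
  fixes p q :: real
  assumes "\<And>y. u \<le> p + y * q \<and> p + y * q \<le> v"
  shows "q = 0"
proof (rule ccontr)
  assume "q \<noteq> 0"
  then show False
    using assms[of "(v + 1 - p) / q"] by simp
qed

text \<open>Two points at distance 1 in a closed unit interval are its endpoints, and these are
  integers here.\<close>

lemma unit_interval_affine: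
  fixes s :: int and b :: real
  assumes "s \<in> {1, -1}" "of_int k \<le> b" "b \<le> of_int k + 1"
    "of_int k \<le> b + of_int s" "b + of_int s \<le> of_int k + 1"
  shows "\<exists>m::int. b = of_int m"
proof (cases "s = 1")
  case True
  then have "b = of_int k" using assms by auto
  then show ?thesis by blast
next
  case False
  then have "b = of_int (k + 1)" using assms by auto
  then show ?thesis by blast
qed

lemma square_eq_1_int:
  assumes "(x::real)\<^sup>2 = 1"
  obtains s :: int where "x = of_int s" "s \<in> {1, -1}"
  using assms that[of 1] that[of "-1"] by (auto simp: power2_eq_1_iff)

text \<open>Vertical lines in the warp must stay in a strip of bounded width, so the linear part is
  diagonal with entries of absolute value 1. Opposite edges of a warp and of a weft then force the
  translation part to be integral.\<close>

lemma strip_isometry_keeping_warps: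
  assumes g: "plane_isometry g" and strips: "\<And>s. \<exists>t. g ` strip s = strip t"
    and warp: "g ` strip (Warp i) = strip (Warp i')"
  obtains s k t l where "s \<in> {1, -1}" "t \<in> {1, -1}" "g = lattice_map s k t l"
proof -
  from plane_isometry_affine[OF g] obtain a d where
    ad: "\<And>z. g z = g 0 + of_real (Re z) * a + of_real (Im z) * d"
    "(Re a)\<^sup>2 + (Im a)\<^sup>2 = 1" "(Re d)\<^sup>2 + (Im d)\<^sup>2 = 1" "Re a * Re d + Im a * Im d = 0"
    by metis
  have re: "Re (g (Complex x y)) = Re (g 0) + x * Re a + y * Re d"
    and im: "Im (g (Complex x y)) = Im (g 0) + x * Im a + y * Im d" for x y
    by (subst ad(1), simp)+
  have W: "of_int i' \<le> Re (g (Complex x y)) \<and> Re (g (Complex x y)) \<le> of_int i' + 1"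
    if "of_int i \<le> x" "x \<le> of_int i + 1" for x y
    using image_eqI[of "g (Complex x y)" g "Complex x y" "strip (Warp i)"] that
    unfolding warp by simp
  have "Re d = 0"
    by (rule bounded_affine_imp_zero[of "of_int i'" "Re (g 0) + of_int i * Re a" _ "of_int i' + 1"])
      (use W[of "of_int i"] in \<open>simp add: re\<close>)
  with ad have "(Im d)\<^sup>2 = 1" "Im a = 0" "(Re a)\<^sup>2 = 1"
    by auto
  then obtain s t :: int where st: "Re a = of_int s" "Im d = of_int t" "s \<in> {1, -1}" "t \<in> {1, -1}"
    by (metis square_eq_1_int)
  obtain k where k: "Re (g 0) + of_int i * of_int s = of_int k"
    using unit_interval_affine[of s i' "Re (g 0) + of_int i * of_int s"]
      W[of "of_int i" 0] W[of "of_int i + 1" 0] st \<open>Re d = 0\<close>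
    by (auto simp: re algebra_simps)
  obtain T where T: "g ` strip (Weft 0) = strip T"
    using strips by blast
  have V: "g (Complex x y) \<in> strip T" if "0 \<le> y" "y \<le> 1" for x y
    unfolding T[symmetric] using that by auto
  \<comment> \<open>If the weft 0 became a warp, the real part would be bounded along a horizontal
    line, contradicting \<open>(Re a)\<^sup>2 = 1\<close>.\<close>
  obtain j where j: "T = Weft j"
  proof (cases T)
    case (Warp j)
    have "Re a = 0"
      by (rule bounded_affine_imp_zero[of "of_int j" "Re (g 0)" _ "of_int j + 1"])
        (use V[of 0] Warp in \<open>simp add: re\<close>)
    with \<open>(Re a)\<^sup>2 = 1\<close> show ?thesis by simp
  qed
  obtain l where l: "Im (g 0) = of_int l"
    using unit_interval_affine[of t j "Im (g 0)"] V[of 0 0] V[of 1 0] st j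
    by (auto simp: im)
  \<comment> \<open>\<open>k\<close> was read off at the left edge of the warp \<open>i\<close>, so
    the offset at the origin is smaller by \<open>i * s\<close>.\<close>
  have "g = lattice_map s (k - i * s) t l"
    using k l st \<open>Re d = 0\<close> \<open>Im a = 0\<close>
    by (intro ext, subst ad(1)) (auto simp: lattice_map_def complex_eq_iff)
  with st that show thesis by blast
qed

lemma strip_isometry_warp_to_weft:
  assumes g: "plane_isometry g" and strips: "\<And>s. \<exists>t. g ` strip s = strip t"
    and weft: "g ` strip (Warp i) = strip (Weft i')"
  obtains s k t l where "s \<in> {1, -1}" "t \<in> {1, -1}" "g = lattice_map s k t l \<circ> transp"
proof -
  let ?f = "transp \<circ> g"
  have "plane_isometry ?f"
    using g by (simp add: plane_isometry_def transp_def dist_complex_def cmod_def add.commute)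
  moreover have "\<exists>t. ?f ` strip s = strip t" for s
    using strips[of s] by (metis image_comp transp_strip)
  moreover have "?f ` strip (Warp i) = strip (Warp i')"
    by (metis image_comp weft transp_strip transp_strand.simps(2))
  ultimately obtain s k t l where st: "s \<in> {1, -1}" "t \<in> {1, -1}"
    and f: "?f = lattice_map s k t l"
    by (rule strip_isometry_keeping_warps)
  \<comment> \<open>Moving \<open>transp\<close> from the left of a lattice map to its right swaps
    the two coordinates' parameters.\<close>
  have "g = lattice_map t l s k \<circ> transp"
  proof
    fix z
    show "g z = (lattice_map t l s k \<circ> transp) z"
      using fun_cong[OF f, of z] by (simp add: lattice_map_def transp_def complex_eq_iff)
  qed
  with st that show thesis by blast
qed

section \<open>Symmetries as colour conditions on the design\<close>

lemma symmetry_groupD: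
  assumes "(g, \<epsilon>) \<in> symmetry_group c"
  shows "plane_isometry g" "\<exists>t. g ` strip s = strip t"
  using assms by (auto simp: symmetry_group_def simp del: strip.simps)

text \<open>There are only two colours, so two that both differ from \<open>x\<close> coincide. This
  carries equality of colours through a symmetry whether it preserves or reverses them.\<close>

lemma colour_eqI:
  fixes a b :: colour
  assumes "a = x \<longleftrightarrow> E" "b = x \<longleftrightarrow> E"
  shows "a = b"
  using assms by (cases a; cases b; cases x) auto

lemma symmetry_group_lattice_map_iff:
  assumes "s \<in> {1, -1}" "t \<in> {1, -1}"
  shows "(lattice_map s k t l, \<epsilon>) \<in> symmetry_group c \<longleftrightarrow>
    (\<forall>i j. c (strand_index s k i) (strand_index t l j) = c i j \<longleftrightarrow> \<epsilon> = No_Flip)"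
proof -
  have "map_strand s k t l (upper c i j) =
      (case \<epsilon> of No_Flip \<Rightarrow> upper c (strand_index s k i) (strand_index t l j)
        | Flip \<Rightarrow> lower c (strand_index s k i) (strand_index t l j))
    \<longleftrightarrow> (c (strand_index s k i) (strand_index t l j) = c i j \<longleftrightarrow> \<epsilon> = No_Flip)" for i j
    by (auto simp: upper_def lower_def split: colour.splits side.splits)
  then show ?thesis
    using plane_isometry_lattice_map[OF assms]
    by (simp add: symmetry_group_def lattice_map_strip[OF assms] lattice_map_cell[OF assms]
        strip_eq_iff cell_eq_iff del: strip.simps)
qed

text \<open>Exchanging warps and wefts exchanges the meanings of the two colours, so here preserved
  colours go with \<open>Flip\<close>.\<close>

lemma symmetry_group_lattice_map_transp:
  assumes st: "s \<in> {1, -1}" "t \<in> {1, -1}"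
    and "(lattice_map s k t l \<circ> transp, \<epsilon>) \<in> symmetry_group c"
  shows "c (strand_index s k j) (strand_index t l i) = c i j \<longleftrightarrow> \<epsilon> = Flip"
proof -
  define g where "g = lattice_map s k t l \<circ> transp"
  have strip: "g ` strip r = strip (map_strand s k t l (transp_strand r))"
    and cell: "g ` cell i j = cell (strand_index s k j) (strand_index t l i)" for r i j
    unfolding g_def image_comp[symmetric] transp_strip transp_cell
    by (rule lattice_map_strip[OF st] lattice_map_cell[OF st])+
  have "map_strand s k t l (transp_strand (upper c i j)) =
      (case \<epsilon> of No_Flip \<Rightarrow> upper c (strand_index s k j) (strand_index t l i)
        | Flip \<Rightarrow> lower c (strand_index s k j) (strand_index t l i))"
    using assms(3) unfolding g_def[symmetric]
    by (simp add: symmetry_group_def strip cell strip_eq_iff cell_eq_iff del: strip.simps)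
  then show ?thesis
    by (auto simp: upper_def lower_def split: colour.splits side.splits)
qed

section \<open>Rotations, axes and parallelism in complex coordinates\<close>

lemma rotation_in_planar_group:
  assumes "(\<lambda>z. b + a * z) \<in> planar_group c" "norm a = 1" "a \<noteq> 1"
  shows "\<exists>p \<theta>. rotation p \<theta> \<in> planar_group c \<and> rotation p \<theta> \<noteq> id"
proof -
  \<comment> \<open>The centre is the fixed point, the solution of
    \<open>p = b + a * p\<close>.\<close>
  define p where "p = b / (1 - a)"
  have "p * (1 - a) = b"
    using assms by (simp add: p_def)
  moreover have "cis (Arg a) = a"
    using assms by (metis cis_Arg norm_zero sgn_div_norm zero_neq_one inverse_1 scaleR_one)
  ultimately have rot: "rotation p (Arg a) = (\<lambda>z. b + a * z)"
    by (auto simp: rotation_def algebra_simps)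
  have "(\<lambda>z. b + a * z) \<noteq> id"
  proof
    assume "(\<lambda>z. b + a * z) = id"
    from fun_cong[OF this, of 0] fun_cong[OF this, of 1] show False
      using assms by simp
  qed
  then show ?thesis
    using rot assms(1) by metis
qed

text \<open>The linear part fixes the direction \<open>u\<close>, and the axis passes through the
  midpoint of 0 and its image \<open>b\<close>.\<close>

lemma axis_in_symmetry_axes:
  assumes g: "(\<lambda>z. b + a * cnj z) \<in> planar_group c" and u: "u \<noteq> 0" "u = a * cnj u"
  shows "line (b / 2) u \<in> symmetry_axes c"
proof -
  have a: "a = u / cnj u"
    using u by (simp add: field_simps)
  \<comment> \<open>Applying the map twice translates by \<open>b + a * cnj b\<close>, twice the
    glide; \<open>w\<close> measures the glide in units of \<open>u\<close> and is real.\<close>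
  define w where "w = (b + a * cnj b) / (2 * u)"
  have "cnj w = w"
    using u(1) by (simp add: w_def a field_simps)
  then have w: "of_real (Re w) * u = (b + a * cnj b) / 2"
  proof -
    have "of_real (Re w) = w"
      using \<open>cnj w = w\<close> by (simp add: Reals_cnj_iff)
    then show ?thesis
      using u(1) by (simp add: w_def)
  qed
  have "glide_reflection (b / 2) u (Re w) = (\<lambda>z. b + a * cnj z)"
    using u(1) unfolding glide_reflection_def reflection_def w by (auto simp: a field_simps)
  moreover have "glide_reflection (b / 2) u 0 = reflection (b / 2) u"
    by (auto simp: glide_reflection_def)
  ultimately show ?thesis
    unfolding symmetry_axes_def using u(1) g by (cases "Re w = 0") fastforce+
qed

text \<open>The points \<open>q\<close> and \<open>q + v\<close> are translates of two points of the
  first line, whose difference is a real multiple of \<open>u\<close>.\<close>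

lemma affine_parallel_lines:
  assumes "affine_parallel (line p u) (line q v)"
  shows "\<exists>t::real. v = of_real t * u"
proof -
  obtain m where m: "line q v = (\<lambda>x. m + x) ` line p u"
    using assms by (auto simp: affine_parallel_def)
  have "q \<in> line q v" "q + v \<in> line q v"
    unfolding line_def by (auto intro: exI[of _ 0] exI[of _ 1])
  then obtain r r' :: real where "q = m + (p + of_real r * u)" "q + v = m + (p + of_real r' * u)"
    unfolding m unfolding line_def by blast
  then have "v = of_real (r' - r) * u"
    by (simp add: algebra_simps)
  then show ?thesis by blast
qed

section \<open>Constancy along strands and the doubled prefabric\<close>

lemma prefabric_order_eq_1:
  assumes "\<And>j. c 0 (j + 1) = c 0 j"
  shows "prefabric_order c = 1"
  unfolding prefabric_order_def strand_period_def
  by (rule Least_equality) (auto simp: assms)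

theorem theorem1:
  fixes P :: design
  assumes "periodic P" and "isonemal P"
    and "prefabric_order P > 4"
    and "only_parallel_axes P"
  shows "\<not> isonemal (doubling P)"
proof
  assume "isonemal (doubling P)"
  then obtain g \<epsilon> where g: "(g, \<epsilon>) \<in> symmetry_group (doubling P)"
    "g ` strip (Warp 0) = strip (Warp 1)"
    unfolding isonemal_def by blast
  from \<open>isonemal P\<close> obtain h \<eta> where h: "(h, \<eta>) \<in> symmetry_group P"
    "h ` strip (Warp 0) = strip (Weft 0)"
    unfolding isonemal_def by blast
  have norot: "\<And>p \<theta>. rotation p \<theta> \<in> planar_group P \<Longrightarrow> rotation p \<theta> = id"
    and parallel: "\<And>L M. L \<in> symmetry_axes P \<Longrightarrow> M \<in> symmetry_axes P \<Longrightarrow> affine_parallel L M"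
    using assms(4) by (auto simp: only_parallel_axes_def)
  obtain s k t l where st: "s \<in> {1, -1}" "t \<in> {1, -1}" and h_eq: "h = lattice_map s k t l \<circ> transp"
    by (rule strip_isometry_warp_to_weft[OF symmetry_groupD[OF h(1)] h(2)])
  have hP: "P (strand_index s k j) (strand_index t l i) = P i j \<longleftrightarrow> \<eta> = Flip" for i j
    using symmetry_group_lattice_map_transp[OF st] h h_eq by blast
  have h_planar: "h \<in> planar_group P"
    using h by (auto simp: planar_group_def)
  \<comment> \<open>Unequal signs would make \<open>h\<close> a quarter-turn about some
    point.\<close>
  have "t = s"
  proof (rule ccontr)
    assume "t \<noteq> s"
    then have "h = (\<lambda>z. Complex k l + (- of_int s * \<i>) * z)"
      using st by (auto simp: h_eq fun_eq_iff lattice_map_def transp_def complex_eq_iff)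
    with h_planar rotation_in_planar_group[of "Complex k l" "- of_int s * \<i>" P] norot st
    show False by (auto simp: complex_eq_iff norm_mult)
  qed
  then have "h = (\<lambda>z. Complex k l + (of_int s * \<i>) * cnj z)"
    using st by (auto simp: h_eq fun_eq_iff lattice_map_def transp_def complex_eq_iff)
  with h_planar have diagonal: "line (Complex k l / 2) (1 + of_int s * \<i>) \<in> symmetry_axes P"
    using axis_in_symmetry_axes[of "Complex k l" "of_int s * \<i>" P "1 + of_int s * \<i>"] st
    by (auto simp: complex_eq_iff)
  have not_const_warp: "\<not> (\<forall>i j. P i (j + 1) = P i j)"
    using prefabric_order_eq_1[of P] assms(3) by fastforce
  \<comment> \<open>The symmetry \<open>h\<close> turns constancy along wefts into constancy along
    warps, the case just excluded.\<close>
  have not_const_weft: "\<not> (\<forall>i j. P (i + 1) j = P i j)"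
  proof
    assume c: "\<forall>i j. P (i + 1) j = P i j"
    have "P i (j + 1) = P i j" for i j
    proof -
      obtain j' i' where ij: "strand_index s k j' = i" "strand_index t l i' = j"
        using surj_strand_index by meson
      \<comment> \<open>Both neighbours of \<open>i'\<close> are treated, since \<open>h\<close> may
        reverse the direction and either one may land on \<open>j + 1\<close>.\<close>
      have P: "P (strand_index s k j') (strand_index t l (i' + 1)) = P (strand_index s k j') (strand_index t l i')"
        "P (strand_index s k j') (strand_index t l (i' - 1)) = P (strand_index s k j') (strand_index t l i')"
        using hP[of j' i'] hP[of j' "i' + 1"] hP[of j' "i' - 1"] c
          c[rule_format, of "i' - 1" j']
        by (auto intro: colour_eqI)
      have "strand_index t l (i' + 1) = j + 1 \<or> strand_index t l (i' - 1) = j + 1"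
        using ij by (auto simp: strand_index_def)
      then show ?thesis using P ij by metis
    qed
    then show False using not_const_warp by blast
  qed
  obtain s' k' t' l' where st': "s' \<in> {1, -1}" "t' \<in> {1, -1}" and g_eq: "g = lattice_map s' k' t' l'"
    by (rule strip_isometry_keeping_warps[OF symmetry_groupD[OF g(1)] g(2)])
  have gP: "doubling P (strand_index s' k' i) (strand_index t' l' j) = doubling P i j \<longleftrightarrow> \<epsilon> = No_Flip"
    for i j
    using symmetry_group_lattice_map_iff[OF st'] g g_eq by blast
  have k': "strand_index s' k' 0 = 1"
    using g(2) by (simp add: g_eq lattice_map_strip[OF st'] strip_eq_iff del: strip.simps)
  have "s' = -1"
  proof (rule ccontr)
    assume "s' \<noteq> -1"
    then have "s' = 1" "k' = 1"
      using st' k' by (auto simp: strand_index_def)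
    have "P (i + 1) j = P i j" for i j
    proof -
      obtain j' where j': "strand_index t' l' j' = 2 * j"
        using surj_strand_index by meson
      \<comment> \<open>Columns \<open>2 * i\<close> and \<open>2 * i + 1\<close> share a block, but
        the shift by 1 carries them across a block boundary.\<close>
      have "doubling P (2 * i) j' = doubling P (2 * i + 1) j'"
        by (simp add: doubling_def)
      then have "doubling P (2 * i + 1) (2 * j) = doubling P (2 * i + 2) (2 * j)"
        using gP[of "2 * i" j'] gP[of "2 * i + 1" j'] j' \<open>s' = 1\<close> \<open>k' = 1\<close>
        by (intro colour_eqI) (auto simp: strand_index_def add.assoc)
      moreover have "(2 * i + 2) div 2 = i + 1"
        by presburger
      ultimately show ?thesis
        by (simp add: doubling_def)
    qed
    then show False using not_const_weft by blast
  qed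
  then have "k' = 2"
    using k' by (simp add: strand_index_def)
  have "even l'"
  proof (rule ccontr)
    assume "odd l'"
    then obtain m where m: "l' = 2 * m + 1"
      by (auto elim: oddE)
    have "P i (j + 1) = P i j" for i j
    proof -
      obtain i' where i': "strand_index s' k' i' = 2 * i"
        using surj_strand_index by meson
      \<comment> \<open>Chosen so that the equal rows \<open>2 * j'\<close> and
        \<open>2 * j' + 1\<close> land, in some order, on rows \<open>2 * j + 1\<close> and
        \<open>2 * j + 2\<close> of adjacent blocks.\<close>
      define j' where "j' = (if t' = 1 then j - m else m - 1 - j)"
      have "doubling P i' (2 * j') = doubling P i' (2 * j' + 1)"
        by (simp add: doubling_def)
      then have "doubling P (2 * i) (strand_index t' l' (2 * j')) =
          doubling P (2 * i) (strand_index t' l' (2 * j' + 1))"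
        using gP[of i' "2 * j'"] gP[of i' "2 * j' + 1"] i'
        by (intro colour_eqI) auto
      moreover have "{strand_index t' l' (2 * j'), strand_index t' l' (2 * j' + 1)} = {2 * j + 1, 2 * j + 2}"
        by (auto simp: strand_index_def j'_def m)
      ultimately have "doubling P (2 * i) (2 * j + 1) = doubling P (2 * i) (2 * j + 2)"
        by (metis doubleton_eq_iff)
      moreover have "(2 * j + 2) div 2 = j + 1"
        by presburger
      ultimately show ?thesis
        by (simp add: doubling_def)
    qed
    then show False using not_const_warp by blast
  qed
  then obtain m where m: "l' = 2 * m"
    by blast
  have "P (strand_index (-1) 1 i) (strand_index t' m j) = P i j \<longleftrightarrow> \<epsilon> = No_Flip" for i j
  proof -
    \<comment> \<open>The offsets are halved to 1 and \<open>m\<close>; for a reversed direction,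
      rounding down in \<open>div\<close> absorbs the odd index.\<close>
    have "strand_index s' k' (2 * i) div 2 = strand_index (-1) 1 i"
      "strand_index t' l' (2 * j) div 2 = strand_index t' m j"
      using \<open>s' = -1\<close> \<open>k' = 2\<close> m by (auto simp: strand_index_def)
    then show ?thesis
      using gP[of "2 * i" "2 * j"] by (simp add: doubling_def)
  qed
  then have half: "lattice_map (-1) 1 t' m \<in> planar_group P"
    using symmetry_group_lattice_map_iff[of "-1" t'] st' unfolding planar_group_def by blast
  show False
  proof (cases "t' = 1")
    case True
    then have "lattice_map (-1) 1 t' m = (\<lambda>z. Complex 1 m + (-1) * cnj z)"
      by (auto simp: fun_eq_iff lattice_map_def complex_eq_iff)
    then have "line (Complex 1 m / 2) \<i> \<in> symmetry_axes P"
      using axis_in_symmetry_axes[of "Complex 1 m" "-1" P \<i>] half by auto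
    \<comment> \<open>A real multiple of \<open>\<i>\<close> has real part 0, while the diagonal
      direction has real part 1.\<close>
    from affine_parallel_lines[OF parallel[OF this diagonal]]
    show False by (auto simp: complex_eq_iff)
  next
    case False
    then have "lattice_map (-1) 1 t' m = (\<lambda>z. Complex 1 m + (-1) * z)"
      using st' by (auto simp: fun_eq_iff lattice_map_def complex_eq_iff)
    then show False
      using rotation_in_planar_group[of "Complex 1 m" "-1" P] half norot by auto
  qed
qed

end
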